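(* Let $R$ be a commutative ring with $1$ such that $\frac12\in R$, let $\mathcal{X}_R=\mathrm{Hom}(R,\mathbb{R})$ be nonempty, and assume the map $R\to C(\mathcal{X}_R)$, $a\mapsto\hat a$, is injective. If $K$ is an infinite, compact subset of $\mathcal{X}_R$, then the $\|\cdot\|_K$-topology on $R$ is strictly finer than $\mathcal{T}_K$.
   Context: $\mathcal{X}_R=\mathrm{Hom}(R,\mathbb{R})$ is the set of unitary ring homomorphisms $\alpha:R\to\mathbb{R}$, with the subspace topology inherited from the product topology on $\mathbb{R}^R$. For $a\in R$, $\hat a:\mathcal{X}_R\to\mathbb{R}$ is $\hat a(\alpha)=\alpha(a)$. $\mathcal{T}_K$ is the topology on $R$ generated by the ring-seminorms $\rho_\alpha(a)=|\alpha(a)|$, $\alpha\in K$: a neighborhood basis at $a$ is given by the sets $\{b\in R:|\alpha_i(a-b)|<\epsilon,\ i=1,\dots,m\}$ with $\epsilon>0$ and $\alpha_1,\dots,\alpha_m\in K$. For $K$ compact, $\|a\|_K:=\sup_{\alpha\in K}|\alpha(a)|$ for $a\in R$, and the $\|\cdot\|_K$-topology on $R$ is the one whose neighborhoods of $a$ are generated by the balls $\{b\in R:\|a-b\|_K<\epsilon\}$, $\epsilon>0$. *)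

theory Defs
  imports "HOL-Analysis.Analysis"
begin

definition real_homs :: "('a::comm_ring_1 \<Rightarrow> real) set" where
  "real_homs = {\<alpha>. \<alpha> 1 = 1 \<and> (\<forall>a b. \<alpha> (a + b) = \<alpha> a + \<alpha> b) \<and> (\<forall>a b. \<alpha> (a * b) = \<alpha> a * \<alpha> b)}"

definition hom_space :: "('a::comm_ring_1 \<Rightarrow> real) topology" where
  "hom_space = subtopology (product_topology (\<lambda>_. euclideanreal) UNIV) real_homs"

(* Restricting to real_homs makes equality of two values of hat
   the equality of functions on the space of homomorphisms only. *)
definition hat :: "'a::comm_ring_1 \<Rightarrow> ('a \<Rightarrow> real) \<Rightarrow> real" where
  "hat a = (\<lambda>\<alpha>\<in>real_homs. \<alpha> a)"

definition seminorms_topology :: "('a::comm_ring_1 \<Rightarrow> real) set \<Rightarrow> 'a topology" where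
  "seminorms_topology K = topology_generated_by
     {{b. \<forall>\<alpha>\<in>F. \<bar>\<alpha> (a - b)\<bar> < \<epsilon>} | a F \<epsilon>. finite F \<and> F \<subseteq> K \<and> \<epsilon> > 0}"

(* Meaningful only if K is nonempty and every evaluation is bounded on K,
   as is the case for nonempty compact K. *)
definition sup_norm :: "('a::comm_ring_1 \<Rightarrow> real) set \<Rightarrow> 'a \<Rightarrow> real" where
  "sup_norm K a = (SUP \<alpha>\<in>K. \<bar>\<alpha> a\<bar>)"

definition sup_norm_topology :: "('a::comm_ring_1 \<Rightarrow> real) set \<Rightarrow> 'a topology" where
  "sup_norm_topology K = topology_generated_by {{b. sup_norm K (a - b) < \<epsilon>} | a \<epsilon>. \<epsilon> > 0}"

lemma topspace_hom_space: "topspace hom_space = real_homs"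
  by (simp add: hom_space_def)

lemma continuous_map_hat: "continuous_map hom_space euclideanreal (hat a)"
proof -
  have "continuous_map hom_space euclideanreal (\<lambda>\<alpha>. \<alpha> a)"
    unfolding hom_space_def
    by (intro continuous_map_from_subtopology continuous_map_product_projection) simp
  then show ?thesis
    by (rule continuous_map_eq) (simp add: hat_def topspace_hom_space)
qed

lemma real_homs_diff:
  assumes "\<alpha> \<in> real_homs"
  shows "\<alpha> (a - b) = \<alpha> a - \<alpha> b"
proof -
  have "\<alpha> (a - b + b) = \<alpha> (a - b) + \<alpha> b"
    using assms unfolding real_homs_def by blast
  then show ?thesis by simp
qed

lemma bdd_above_evaluation:
  assumes "compactin hom_space K"
  shows "bdd_above ((\<lambda>\<alpha>. \<bar>\<alpha> a\<bar>) ` K)"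
proof -
  have sub: "K \<subseteq> real_homs"
    using compactin_subset_topspace[OF assms] by (simp add: topspace_hom_space)
  have "compact (hat a ` K)"
    using image_compactin[OF assms continuous_map_hat] by simp
  then obtain B where "\<And>x. x \<in> hat a ` K \<Longrightarrow> norm x \<le> B"
    using compact_imp_bounded bounded_iff by metis
  then have "\<bar>\<alpha> a\<bar> \<le> B" if "\<alpha> \<in> K" for \<alpha>
    using sub that by (force simp: hat_def)
  then show ?thesis by (auto intro!: bdd_aboveI)
qed

lemma openin_generated_by_nhds:
  fixes N :: "'i \<Rightarrow> 'a \<Rightarrow> 'a set"
  assumes self: "\<And>i a. i \<in> I \<Longrightarrow> a \<in> N i a"
    and open_N: "\<And>i a c. i \<in> I \<Longrightarrow> c \<in> N i a \<Longrightarrow> \<exists>j\<in>I. N j c \<subseteq> N i a"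
    and Int_N: "\<And>i j a. i \<in> I \<Longrightarrow> j \<in> I \<Longrightarrow> \<exists>k\<in>I. N k a \<subseteq> N i a \<inter> N j a"
    and ne: "I \<noteq> {}"
  shows "openin (topology_generated_by {N i a | i a. i \<in> I}) U \<longleftrightarrow> (\<forall>a\<in>U. \<exists>i\<in>I. N i a \<subseteq> U)"
    (is "openin ?T U \<longleftrightarrow> _")
proof
  assume "openin ?T U"
  then have "generate_topology_on {N i a | i a. i \<in> I} U"
    by (simp add: openin_topology_generated_by_iff)
  then show "\<forall>a\<in>U. \<exists>i\<in>I. N i a \<subseteq> U"
  proof induction
    case (Int A B)
    show ?case
    proof
      fix a assume "a \<in> A \<inter> B"
      then obtain i j where "i \<in> I" "N i a \<subseteq> A" "j \<in> I" "N j a \<subseteq> B"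
        using Int.IH by blast
      then show "\<exists>k\<in>I. N k a \<subseteq> A \<inter> B"
        using Int_N[of i j a] by blast
    qed
  next
    case (UN \<A>)
    then show ?case by blast
  next
    case (Basis S)
    then show ?case using open_N by blast
  qed simp
next
  assume *: "\<forall>a\<in>U. \<exists>i\<in>I. N i a \<subseteq> U"
  show "openin ?T U"
  proof (subst openin_subopen, intro ballI)
    fix a assume "a \<in> U"
    then obtain i where i: "i \<in> I" "N i a \<subseteq> U" using * by blast
    then have "openin ?T (N i a)"
      by (intro topology_generated_by_Basis) blast
    then show "\<exists>T. openin ?T T \<and> a \<in> T \<and> T \<subseteq> U"
      using i self by blast
  qed
qed

lemma openin_seminorms_topology:
  fixes K :: "('a::comm_ring_1 \<Rightarrow> real) set"
  assumes K: "K \<subseteq> real_homs"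
  shows "openin (seminorms_topology K) U \<longleftrightarrow>
    (\<forall>a\<in>U. \<exists>F \<epsilon>. finite F \<and> F \<subseteq> K \<and> \<epsilon> > 0 \<and> {b. \<forall>\<alpha>\<in>F. \<bar>\<alpha> (a - b)\<bar> < \<epsilon>} \<subseteq> U)"
proof -
  define I where "I = {(F :: ('a \<Rightarrow> real) set, \<epsilon>::real). finite F \<and> F \<subseteq> K \<and> \<epsilon> > 0}"
  define N where "N = (\<lambda>(F :: ('a \<Rightarrow> real) set, \<epsilon>) (a::'a). {b. \<forall>\<alpha>\<in>F. \<bar>\<alpha> (a - b)\<bar> < (\<epsilon>::real)})"
  have diff: "\<alpha> (a - b) = \<alpha> a - \<alpha> b" if "\<alpha> \<in> K" for \<alpha> a b
    using K that real_homs_diff by blast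
  have "openin (topology_generated_by {N i a | i a. i \<in> I}) U \<longleftrightarrow> (\<forall>a\<in>U. \<exists>i\<in>I. N i a \<subseteq> U)"
  proof (rule openin_generated_by_nhds)
    show "a \<in> N i a" if "i \<in> I" for i a
    proof -
      obtain F \<epsilon> where i: "i = (F, \<epsilon>)" "F \<subseteq> K" "\<epsilon> > 0"
        using \<open>i \<in> I\<close> by (auto simp: I_def)
      have "\<bar>\<alpha> (a - a)\<bar> < \<epsilon>" if "\<alpha> \<in> F" for \<alpha>
      proof -
        have "\<alpha> (a - a) = 0" using diff[of \<alpha> a a] that i(2) by auto
        then show ?thesis using i(3) by simp
      qed
      then show ?thesis by (simp add: N_def i(1))
    qed
    show "\<exists>j\<in>I. N j c \<subseteq> N i a" if ic: "i \<in> I" "c \<in> N i a" for i a c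
    proof -
      obtain F \<epsilon> where i: "i = (F, \<epsilon>)" "finite F" "F \<subseteq> K" "\<epsilon> > 0"
        using ic(1) by (auto simp: I_def)
      define \<delta> where "\<delta> = Min (insert \<epsilon> ((\<lambda>\<alpha>. \<epsilon> - \<bar>\<alpha> (a - c)\<bar>) ` F))"
      have \<delta>: "\<delta> > 0" using i ic(2) by (simp add: \<delta>_def N_def)
      have le: "\<delta> \<le> \<epsilon> - \<bar>\<alpha> (a - c)\<bar>" if "\<alpha> \<in> F" for \<alpha>
        unfolding \<delta>_def using i that by (intro Min_le) auto
      have "N (F, \<delta>) c \<subseteq> N i a"
      proof
        fix b assume b: "b \<in> N (F, \<delta>) c"
        have "\<bar>\<alpha> (a - b)\<bar> < \<epsilon>" if "\<alpha> \<in> F" for \<alpha>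
        proof -
          have "\<alpha> \<in> K" using i(3) that by blast
          moreover have "\<bar>\<alpha> (c - b)\<bar> < \<epsilon> - \<bar>\<alpha> (a - c)\<bar>"
          proof -
            have "\<bar>\<alpha> (c - b)\<bar> < \<delta>" using b that by (simp add: N_def)
            then show ?thesis using le[OF that] by linarith
          qed
          ultimately show ?thesis by (simp add: diff)
        qed
        then show "b \<in> N i a" by (simp add: N_def i(1))
      qed
      moreover have "(F, \<delta>) \<in> I" using i \<delta> by (simp add: I_def)
      ultimately show ?thesis by blast
    qed
    show "\<exists>k\<in>I. N k a \<subseteq> N i a \<inter> N j a" if ij: "i \<in> I" "j \<in> I" for i j a
    proof -
      obtain F \<epsilon> G \<delta> where "i = (F, \<epsilon>)" "j = (G, \<delta>)" by (metis surj_pair)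
      then show ?thesis using ij
        by (intro bexI[of _ "(F \<union> G, min \<epsilon> \<delta>)"]) (auto simp: I_def N_def)
    qed
    show "I \<noteq> {}"
    proof -
      have "({}, 1) \<in> I" by (simp add: I_def)
      then show ?thesis by blast
    qed
  qed
  moreover have "{N i a | i a. i \<in> I} =
      {{b. \<forall>\<alpha>\<in>F. \<bar>\<alpha> (a - b)\<bar> < \<epsilon>} | a F \<epsilon>. finite F \<and> F \<subseteq> K \<and> \<epsilon> > 0}"
    by (intro Collect_cong) (simp add: I_def N_def, blast)
  ultimately show ?thesis
    unfolding seminorms_topology_def by (simp add: I_def N_def)
qed

lemma openin_sup_norm_topology:
  fixes K :: "('a::comm_ring_1 \<Rightarrow> real) set"
  assumes K: "compactin hom_space K" "K \<noteq> {}"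
  shows "openin (sup_norm_topology K) U \<longleftrightarrow>
    (\<forall>a\<in>U. \<exists>\<epsilon>>0. {b. sup_norm K (a - b) < \<epsilon>} \<subseteq> U)"
proof -
  define I where "I = {\<epsilon>::real. \<epsilon> > 0}"
  define N where "N = (\<lambda>\<epsilon> (a::'a). {b. sup_norm K (a - b) < \<epsilon>})"
  have sub: "K \<subseteq> real_homs"
    using compactin_subset_topspace[OF K(1)] by (simp add: topspace_hom_space)
  have diff: "\<alpha> (a - b) = \<alpha> a - \<alpha> b" if "\<alpha> \<in> K" for \<alpha> a b
    using sub that real_homs_diff by blast
  have zero: "sup_norm K (a - a) = 0" for a
  proof -
    have "(\<lambda>\<alpha>. \<bar>\<alpha> (a - a)\<bar>) ` K = {0}"
      using K(2) diff[of _ a a] by force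
    then show ?thesis by (simp add: sup_norm_def)
  qed
  have tri: "sup_norm K (a - b) \<le> sup_norm K (a - c) + sup_norm K (c - b)" for a b c
    unfolding sup_norm_def
  proof (rule cSUP_least[OF K(2)])
    fix \<alpha> assume \<alpha>: "\<alpha> \<in> K"
    have "\<bar>\<alpha> (a - b)\<bar> \<le> \<bar>\<alpha> (a - c)\<bar> + \<bar>\<alpha> (c - b)\<bar>"
      using diff[OF \<alpha>] by simp
    also have "\<dots> \<le> (SUP \<alpha>\<in>K. \<bar>\<alpha> (a - c)\<bar>) + (SUP \<alpha>\<in>K. \<bar>\<alpha> (c - b)\<bar>)"
      by (intro add_mono cSUP_upper[OF \<alpha> bdd_above_evaluation[OF K(1)]])
    finally show "\<bar>\<alpha> (a - b)\<bar> \<le> (SUP \<alpha>\<in>K. \<bar>\<alpha> (a - c)\<bar>) + (SUP \<alpha>\<in>K. \<bar>\<alpha> (c - b)\<bar>)" .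
  qed
  have "openin (topology_generated_by {N i a | i a. i \<in> I}) U \<longleftrightarrow> (\<forall>a\<in>U. \<exists>i\<in>I. N i a \<subseteq> U)"
  proof (rule openin_generated_by_nhds)
    show "a \<in> N i a" if "i \<in> I" for i a
      using that zero[of a] by (simp add: I_def N_def)
    show "\<exists>j\<in>I. N j c \<subseteq> N i a" if "i \<in> I" "c \<in> N i a" for i a c
    proof (rule bexI[of _ "i - sup_norm K (a - c)"])
      show "N (i - sup_norm K (a - c)) c \<subseteq> N i a"
      proof
        fix b assume "b \<in> N (i - sup_norm K (a - c)) c"
        then show "b \<in> N i a" using tri[of a b c] by (simp add: N_def)
      qed
      show "i - sup_norm K (a - c) \<in> I"
        using that by (simp add: I_def N_def)
    qed
    show "\<exists>k\<in>I. N k a \<subseteq> N i a \<inter> N j a" if "i \<in> I" "j \<in> I" for i j a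
      using that by (intro bexI[of _ "min i j"]) (auto simp: I_def N_def)
    show "I \<noteq> {}"
    proof -
      have "1 \<in> I" by (simp add: I_def)
      then show ?thesis by blast
    qed
  qed
  moreover have "{N i a | i a. i \<in> I} = {{b. sup_norm K (a - b) < \<epsilon>} | a \<epsilon>. \<epsilon> > 0}"
    unfolding I_def N_def by fast
  ultimately show ?thesis
    unfolding sup_norm_topology_def by (simp add: I_def N_def Bex_def)
qed

end

(* Since 1/2 lies in R, real constants are limits of dyadic elements of R, and these
   have the same value under every homomorphism to the reals. Finitely many
   homomorphisms F and a further one \<beta> are separated pointwise by elements a_\<alpha>, so
   replacing the real constants by dyadic approximations in the Lagrange product
   y * prod_\<alpha> (a_\<alpha> - \<alpha> a_\<alpha>) / (\<beta> a_\<alpha> - \<alpha> a_\<alpha>) yields elements of R that are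
   arbitrarily small on F and close to y at \<beta>. As K is infinite, no finite F controls
   the sup norm, so the unit ball is not a neighbourhood of 0 in the weaker topology. *)
theory Submission
  imports Defs
begin

lemma real_homs_1: "\<alpha> \<in> real_homs \<Longrightarrow> \<alpha> 1 = 1"
  and real_homs_add: "\<alpha> \<in> real_homs \<Longrightarrow> \<alpha> (a + b) = \<alpha> a + \<alpha> b"
  and real_homs_mult: "\<alpha> \<in> real_homs \<Longrightarrow> \<alpha> (a * b) = \<alpha> a * \<alpha> b"
  by (simp_all add: real_homs_def)

lemma real_homs_0:
  assumes "\<alpha> \<in> real_homs"
  shows "\<alpha> 0 = 0"
  using real_homs_diff[OF assms, of 0 0] by simp

lemma real_homs_power:
  assumes "\<alpha> \<in> real_homs"
  shows "\<alpha> (a ^ n) = \<alpha> a ^ n"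
  by (induction n) (simp_all add: real_homs_1[OF assms] real_homs_mult[OF assms])

lemma real_homs_of_nat:
  assumes "\<alpha> \<in> real_homs"
  shows "\<alpha> (of_nat n) = of_nat n"
  by (induction n) (simp_all add: real_homs_0[OF assms] real_homs_1[OF assms] real_homs_add[OF assms])

lemma real_homs_of_int:
  assumes "\<alpha> \<in> real_homs"
  shows "\<alpha> (of_int n) = of_int n"
  by (cases n rule: int_diff_cases) (simp add: real_homs_diff[OF assms] real_homs_of_nat[OF assms])

lemma real_homs_prod:
  assumes "\<alpha> \<in> real_homs"
  shows "\<alpha> (\<Prod>i\<in>I. f i) = (\<Prod>i\<in>I. \<alpha> (f i))"
  by (induction I rule: infinite_finite_induct)
    (simp_all add: real_homs_1[OF assms] real_homs_mult[OF assms])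

text \<open>The floor moves \<open>x * 2 ^ k\<close> by at most 1, and the factor
  \<open>(1 / 2) ^ k\<close> shrinks this error to 0.\<close>

lemma tendsto_floor_dyadic: "(\<lambda>k. of_int \<lfloor>x * 2 ^ k\<rfloor> * (1 / 2) ^ k) \<longlonglongrightarrow> (x::real)"
proof (rule LIMSEQ_I)
  fix e :: real
  assume "e > 0"
  then obtain N where N: "(1 / 2) ^ N < e"
    using real_arch_pow_inv[of e "1 / 2"] by auto
  show "\<exists>N. \<forall>k\<ge>N. norm (of_int \<lfloor>x * 2 ^ k\<rfloor> * (1 / 2) ^ k - x) < e"
  proof (intro exI allI impI)
    fix k assume "k \<ge> N"
    have "of_int \<lfloor>x * 2 ^ k\<rfloor> * (1 / 2) ^ k - x = (of_int \<lfloor>x * 2 ^ k\<rfloor> - x * 2 ^ k) * (1 / 2) ^ k"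
      by (simp add: field_simps)
    moreover have "\<bar>of_int \<lfloor>x * 2 ^ k\<rfloor> - x * 2 ^ k\<bar> \<le> 1"
      by linarith
    ultimately have "norm (of_int \<lfloor>x * 2 ^ k\<rfloor> * (1 / 2) ^ k - x) \<le> (1 / 2) ^ k"
      by (simp add: abs_mult mult_left_le_one_le)
    also have "\<dots> \<le> (1 / 2) ^ N"
      using \<open>k \<ge> N\<close> by (intro power_decreasing) auto
    finally show "norm (of_int \<lfloor>x * 2 ^ k\<rfloor> * (1 / 2) ^ k - x) < e"
      using N by linarith
  qed
qed

text \<open>The sequence \<open>q x\<close> is chosen before \<open>\<gamma>\<close>: a homomorphism
  has no freedom on dyadic elements, so one sequence serves all of them at once.\<close>

lemma real_constant_approximation:
  assumes half: "\<exists>h::'a::comm_ring_1. 2 * h = 1"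
  obtains q :: "real \<Rightarrow> nat \<Rightarrow> 'a::comm_ring_1"
  where "\<And>x \<gamma>. \<gamma> \<in> real_homs \<Longrightarrow> (\<lambda>k. \<gamma> (q x k)) \<longlonglongrightarrow> x"
proof -
  obtain h :: 'a where h: "2 * h = 1" using half by blast
  show thesis
  proof (rule that[of "\<lambda>x k. of_int \<lfloor>x * 2 ^ k\<rfloor> * h ^ k"])
    fix x :: real and \<gamma> :: "'a \<Rightarrow> real"
    assume \<gamma>: "\<gamma> \<in> real_homs"
    \<comment> \<open>Membership in \<open>real_homs\<close> speaks of sums, products and 1, so the
      numeral is unfolded into a sum; applying \<open>\<gamma>\<close> then doubles
      \<open>\<gamma> h\<close>.\<close>
    have "h + h = 1" using h by (simp only: mult_2)
    then have "\<gamma> h = 1 / 2"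
      using real_homs_add[OF \<gamma>, of h h] real_homs_1[OF \<gamma>] by simp
    then show "(\<lambda>k. \<gamma> (of_int \<lfloor>x * 2 ^ k\<rfloor> * h ^ k)) \<longlonglongrightarrow> x"
      using tendsto_floor_dyadic[of x]
      by (simp only: real_homs_mult[OF \<gamma>] real_homs_of_int[OF \<gamma>] real_homs_power[OF \<gamma>])
  qed
qed

lemma real_homs_interpolation:
  fixes F :: "('a::comm_ring_1 \<Rightarrow> real) set"
  assumes half: "\<exists>h::'a. 2 * h = 1"
    and F: "finite F" "F \<subseteq> real_homs"
    and \<beta>: "\<beta> \<in> real_homs" "\<beta> \<notin> F"
  obtains b :: "nat \<Rightarrow> 'a"
  where "\<And>\<alpha>. \<alpha> \<in> F \<Longrightarrow> (\<lambda>k. \<alpha> (b k)) \<longlonglongrightarrow> 0" and "(\<lambda>k. \<beta> (b k)) \<longlonglongrightarrow> y"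
proof -
  obtain q :: "real \<Rightarrow> nat \<Rightarrow> 'a"
    where q: "\<And>x \<gamma>. \<gamma> \<in> real_homs \<Longrightarrow> (\<lambda>k. \<gamma> (q x k)) \<longlonglongrightarrow> x"
    using real_constant_approximation[OF half] by blast
  have "\<forall>\<alpha>\<in>F. \<exists>a. \<alpha> a \<noteq> \<beta> a"
    using \<beta>(2) by (metis ext)
  then obtain a where a: "\<And>\<alpha>. \<alpha> \<in> F \<Longrightarrow> \<alpha> (a \<alpha>) \<noteq> \<beta> (a \<alpha>)"
    by metis
  \<comment> \<open>\<open>P\<close> is the unnormalised Lagrange product with exact real constants.
    It vanishes on \<open>F\<close>, since \<open>\<gamma> = \<alpha>\<close> kills one factor, and
    its value at \<beta> has no zero factor.\<close>
  define P where "P = (\<lambda>\<gamma>. \<Prod>\<alpha>\<in>F. \<gamma> (a \<alpha>) - \<alpha> (a \<alpha>))"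
  \<comment> \<open>All denominators are collected in the single constant
    \<open>y / P \<beta>\<close>, which is approximated like the other constants.\<close>
  define b where "b = (\<lambda>k. q (y / P \<beta>) k * (\<Prod>\<alpha>\<in>F. a \<alpha> - q (\<alpha> (a \<alpha>)) k))"
  \<comment> \<open>A finite product of convergent sequences converges to the product of the limits;
    the two claims are the cases of \<gamma> in \<open>F\<close> and of \<gamma> equal to
    \<beta>.\<close>
  have lim: "(\<lambda>k. \<gamma> (b k)) \<longlonglongrightarrow> y / P \<beta> * P \<gamma>" if \<gamma>: "\<gamma> \<in> real_homs" for \<gamma>
    unfolding b_def P_def real_homs_mult[OF \<gamma>] real_homs_prod[OF \<gamma>] real_homs_diff[OF \<gamma>]
    by (intro tendsto_intros q \<gamma>)
  have "P \<beta> \<noteq> 0"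
    using F(1) a by (force simp: P_def)
  have "P \<alpha> = 0" if "\<alpha> \<in> F" for \<alpha>
    using F(1) that by (auto simp: P_def)
  then have "(\<lambda>k. \<alpha> (b k)) \<longlonglongrightarrow> 0" if "\<alpha> \<in> F" for \<alpha>
    using lim[of \<alpha>] F(2) that by auto
  moreover have "(\<lambda>k. \<beta> (b k)) \<longlonglongrightarrow> y"
    using lim[OF \<beta>(1)] \<open>P \<beta> \<noteq> 0\<close> by simp
  ultimately show thesis
    by (rule that)
qed

text \<open>Compactness bounds the evaluations on \<open>K\<close>, which makes the supremum a
  genuine upper bound.\<close>

lemma evaluation_le_sup_norm:
  assumes "compactin hom_space K" "\<alpha> \<in> K"
  shows "\<bar>\<alpha> a\<bar> \<le> sup_norm K a"
  unfolding sup_norm_def by (rule cSUP_upper[OF assms(2) bdd_above_evaluation[OF assms(1)]])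

theorem proposition3p6:
  fixes K :: "('a::comm_ring_1 \<Rightarrow> real) set"
  assumes half: "\<exists>h::'a. 2 * h = 1"
    and nonempty: "(real_homs :: ('a \<Rightarrow> real) set) \<noteq> {}"
    and inj_hat: "inj (hat :: 'a \<Rightarrow> ('a \<Rightarrow> real) \<Rightarrow> real)"
    and infinite_K: "infinite K"
    and compact_K: "compactin hom_space K"
  shows "{U. openin (seminorms_topology K) U} \<subset> {U. openin (sup_norm_topology K) U}"
proof -
  have K: "K \<subseteq> real_homs"
    using compactin_subset_topspace[OF compact_K] by (simp add: topspace_hom_space)
  have ne: "K \<noteq> {}" using infinite_K by auto
  have le: "\<bar>\<alpha> a\<bar> \<le> sup_norm K a" if "\<alpha> \<in> K" for \<alpha> a
    using evaluation_le_sup_norm[OF compact_K that] .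
  have finer: "openin (sup_norm_topology K) U" if U: "openin (seminorms_topology K) U" for U
    unfolding openin_sup_norm_topology[OF compact_K ne]
  proof
    fix a assume "a \<in> U"
    then obtain F \<epsilon> where F: "F \<subseteq> K" "\<epsilon> > 0" "{b. \<forall>\<alpha>\<in>F. \<bar>\<alpha> (a - b)\<bar> < \<epsilon>} \<subseteq> U"
      using U unfolding openin_seminorms_topology[OF K] by blast
    \<comment> \<open>The same radius works, because the sup norm dominates each seminorm.\<close>
    have "{b. sup_norm K (a - b) < \<epsilon>} \<subseteq> {b. \<forall>\<alpha>\<in>F. \<bar>\<alpha> (a - b)\<bar> < \<epsilon>}"
      using F(1) le by (blast intro: le_less_trans)
    then show "\<exists>\<epsilon>>0. {b. sup_norm K (a - b) < \<epsilon>} \<subseteq> U"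
      using F(2,3) by blast
  qed
  define B where "B = {b. sup_norm K (0 - b) < 1}"
  have "openin (sup_norm_topology K) B"
    unfolding sup_norm_topology_def B_def
    by (rule topology_generated_by_Basis) (use zero_less_one in blast)
  moreover have "\<not> openin (seminorms_topology K) B"
  proof
    assume open_B: "openin (seminorms_topology K) B"
    \<comment> \<open>As \<open>K\<close> is nonempty, this image is the singleton of 0, so the sup
      norm of 0 is 0.\<close>
    have "(\<lambda>\<alpha>. \<bar>\<alpha> 0\<bar>) ` K = (\<lambda>_. 0) ` K"
    proof (rule image_cong)
      fix \<alpha> assume "\<alpha> \<in> K"
      then have "\<alpha> 0 = 0" using K real_homs_0 by blast
      then show "\<bar>\<alpha> 0\<bar> = 0" by simp
    qed simp
    then have "0 \<in> B"
      using ne by (simp add: B_def sup_norm_def)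
    then have "\<exists>F \<epsilon>. finite F \<and> F \<subseteq> K \<and> \<epsilon> > 0 \<and> {b. \<forall>\<alpha>\<in>F. \<bar>\<alpha> (0 - b)\<bar> < \<epsilon>} \<subseteq> B"
      using open_B by (simp only: openin_seminorms_topology[OF K])
    then obtain F \<epsilon> where F: "finite F" "F \<subseteq> K" "\<epsilon> > 0"
      and sub: "{b. \<forall>\<alpha>\<in>F. \<bar>\<alpha> (0 - b)\<bar> < \<epsilon>} \<subseteq> B"
      by (elim exE conjE)
    obtain \<beta> where \<beta>: "\<beta> \<in> K" "\<beta> \<notin> F"
      using infinite_K F(1) by (meson finite_subset subsetI)
    \<comment> \<open>The value 2 is one choice above the radius 1 of \<open>B\<close>: values
      converging to it eventually exceed 1.\<close>
    obtain b where b: "\<And>\<alpha>. \<alpha> \<in> F \<Longrightarrow> (\<lambda>k. \<alpha> (b k)) \<longlonglongrightarrow> 0" "(\<lambda>k. \<beta> (b k)) \<longlonglongrightarrow> 2"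
    proof (rule real_homs_interpolation[OF half F(1)])
      show "F \<subseteq> real_homs" "\<beta> \<in> real_homs"
        using F(2) \<beta>(1) K by auto
    qed (use \<beta>(2) in auto)
    have "eventually (\<lambda>k. \<bar>\<alpha> (b k)\<bar> < \<epsilon>) sequentially" if "\<alpha> \<in> F" for \<alpha>
      using tendstoD[OF b(1)[OF that] F(3)] by (simp add: dist_real_def)
    \<comment> \<open>Finiteness of \<open>F\<close> lets a single index serve all its
      members.\<close>
    then have "eventually (\<lambda>k. \<forall>\<alpha>\<in>F. \<bar>\<alpha> (b k)\<bar> < \<epsilon>) sequentially"
      using F(1) by (simp add: eventually_ball_finite)
    moreover have "eventually (\<lambda>k. 1 < \<beta> (b k)) sequentially"
      using order_tendstoD(1)[OF b(2)] by simp
    ultimately have "eventually (\<lambda>k. (\<forall>\<alpha>\<in>F. \<bar>\<alpha> (b k)\<bar> < \<epsilon>) \<and> 1 < \<beta> (b k)) sequentially"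
      by (rule eventually_conj)
    then obtain k where k: "\<forall>\<alpha>\<in>F. \<bar>\<alpha> (b k)\<bar> < \<epsilon>" "1 < \<beta> (b k)"
      using eventually_happens'[OF sequentially_bot] by blast
    have neg: "\<bar>\<alpha> (0 - b k)\<bar> = \<bar>\<alpha> (b k)\<bar>" if "\<alpha> \<in> K" for \<alpha>
      using real_homs_diff[of \<alpha> 0 "b k"] real_homs_0[of \<alpha>] K that by auto
    have "\<forall>\<alpha>\<in>F. \<bar>\<alpha> (0 - b k)\<bar> < \<epsilon>"
    proof
      fix \<alpha> assume "\<alpha> \<in> F"
      then show "\<bar>\<alpha> (0 - b k)\<bar> < \<epsilon>"
        using neg[of \<alpha>] k(1) F(2) by auto
    qed
    then have "b k \<in> B"
      by (intro subsetD[OF sub] CollectI)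
    \<comment> \<open>Membership in \<open>B\<close> puts the sup norm below 1, yet it is at least
      the absolute value at \<beta>, which exceeds 1.\<close>
    then show False
      using le[OF \<beta>(1), of "0 - b k"] neg[OF \<beta>(1)] k(2) by (simp add: B_def)
  qed
  ultimately show ?thesis
    using finer by blast
qed

end
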